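(* Let $\langle X_*,f_*\rangle$ and $\langle Y_*,g_*\rangle$ be sequences in a locally complete MU-category $\mathcal{K}$. Let $f_{m_*}$ and $g_{n_*}$ be subsequences (of $f_*$ and $g_*$, given by strictly increasing $m_*,n_*\colon\omega\to\omega$) with epsilon sequences $\langle\delta_k\rangle_{k\in\omega}$ and $\langle\varepsilon_k\rangle_{k\in\omega}$, respectively. Suppose that $h_*$ is a sequence in $\mathcal{K}$ such that for every $k\in\omega$: (i) $h_{2k}\colon X_{m_k}\to Y_{n_k}$ is $\langle\varepsilon_k/2,\delta_k\rangle$-continuous and $h_{2k+1}\colon Y_{n_{k+1}}\to X_{m_k}$ is $\langle\delta_k/2,\varepsilon_{k+1}\rangle$-continuous; (ii) $h_{2k}\circ h_{2k+1}\approx_{\varepsilon_k/2}g_{n_k,n_{k+1}}$ and $h_{2k+1}\circ h_{2k+2}\approx_{\delta_k/2}f_{m_k,m_{k+1}}$. Then $f_*$ has a limit if and only if $g_*$ has a limit, and for all such limits $\langle X_\infty,f_{*,\infty}\rangle$ and $\langle Y_\infty,g_{*,\infty}\rangle$ there is an isomorphism $h_\infty\colon X_\infty\to Y_\infty$ such that $h_0\circ f_{m_0,\infty}\approx_{2\varepsilon_0}g_{n_0,\infty}\circ h_\infty$.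
   Context: An $\infty$-metric is a metric allowed to take the value $\infty$. An MU-category is a category $\mathcal{K}$ with an $\infty$-metric $d$ on every hom-set such that (1) $d(g\circ f,h\circ f)\le d(g,h)$ for all $\mathcal{K}$-maps $f$ and all compatible $g,h$, and (2) for every $\mathcal{K}$-map $f$ and $\varepsilon>0$ there is $\delta>0$ such that $f$ is $\langle\varepsilon,\delta\rangle$-continuous, i.e. for every $\mathcal{K}$-object $W$ and all $\mathcal{K}$-maps $g,h\colon W\to\mathrm{dom}(f)$, $d(g,h)<\delta$ implies $d(f\circ g,f\circ h)<\varepsilon$. It is locally complete if all the hom-spaces are complete. We write $f\approx_\varepsilon g$ for $d(f,g)<\varepsilon$. A sequence $\langle X_*,f_*\rangle$ in $\mathcal{K}$ consists of $\mathcal{K}$-objects $X_n$ and $\mathcal{K}$-maps $f_n\colon X_{n+1}\to X_n$, $n\in\omega$; for $n\le n'$ put $f_{n,n'}=f_n\circ\cdots\circ f_{n'-1}\colon X_{n'}\to X_n$ (so $f_{n,n}=\mathrm{id}$). The subsequence given by a strictly increasing $m_*\colon\omega\to\omega$ has objects $X_{m_k}$ and maps $f_{m_k,m_{k+1}}$. A limit $\langle X_\infty,f_{*,\infty}\rangle$ is a category-theoretic inverse limit with limit cone maps $f_{n,\infty}\colon X_\infty\to X_n$. An epsilon sequence for $f_*$ is a sequence $\langle\varepsilon_n\rangle_{n\in\omega}$ of strictly positive reals such that $f_{n,n'}$ is $\langle\varepsilon_n/2^{n'-n},\varepsilon_{n'}\rangle$-continuous for every $n\le n'\in\omega$. *)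

theory Defs
  imports Complex_Main "HOL-Library.Extended_Nonnegative_Real"
begin

record ('o, 'm) category =
  Obj :: "'o set"
  Arr :: "'m set"
  Dom :: "'m \<Rightarrow> 'o"
  Cod :: "'m \<Rightarrow> 'o"
  Ident :: "'o \<Rightarrow> 'm"
  Comp :: "'m \<Rightarrow> 'm \<Rightarrow> 'm"  (infixr "\<cdot>\<index>" 70)

definition Hom :: "('o, 'm, 'z) category_scheme \<Rightarrow> 'o \<Rightarrow> 'o \<Rightarrow> 'm set" where
  "Hom K A B = {f \<in> Arr K. Dom K f = A \<and> Cod K f = B}"

text \<open>\<open>g \<cdot> f\<close> means \<open>g\<close> after \<open>f\<close>; it is unconstrained when \<open>Dom g \<noteq> Cod f\<close>.\<close>

locale category =
  fixes K :: "('o, 'm, 'z) category_scheme" (structure)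
  assumes Dom_in_Obj: "f \<in> Arr K \<Longrightarrow> Dom K f \<in> Obj K"
    and Cod_in_Obj: "f \<in> Arr K \<Longrightarrow> Cod K f \<in> Obj K"
    and Ident_in_Hom: "A \<in> Obj K \<Longrightarrow> Ident K A \<in> Hom K A A"
    and Comp_in_Hom: "\<lbrakk>f \<in> Hom K A B; g \<in> Hom K B C\<rbrakk> \<Longrightarrow> g \<cdot> f \<in> Hom K A C"
    and Comp_Ident: "f \<in> Hom K A B \<Longrightarrow> f \<cdot> Ident K A = f"
    and Ident_Comp: "f \<in> Hom K A B \<Longrightarrow> Ident K B \<cdot> f = f"
    and Comp_assoc: "\<lbrakk>f \<in> Hom K A B; g \<in> Hom K B C; h \<in> Hom K C D\<rbrakk>
                       \<Longrightarrow> (h \<cdot> g) \<cdot> f = h \<cdot> (g \<cdot> f)"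

definition isomorphism :: "('o, 'm, 'z) category_scheme \<Rightarrow> 'o \<Rightarrow> 'o \<Rightarrow> 'm \<Rightarrow> bool" where
  "isomorphism K A B u \<longleftrightarrow> u \<in> Hom K A B \<and>
     (\<exists>v \<in> Hom K B A. v \<cdot>\<^bsub>K\<^esub> u = Ident K A \<and> u \<cdot>\<^bsub>K\<^esub> v = Ident K B)"

definition infty_metric_on :: "'a set \<Rightarrow> ('a \<Rightarrow> 'a \<Rightarrow> ennreal) \<Rightarrow> bool" where
  "infty_metric_on S d \<longleftrightarrow>
     (\<forall>x\<in>S. \<forall>y\<in>S. d x y = 0 \<longleftrightarrow> x = y) \<and>
     (\<forall>x\<in>S. \<forall>y\<in>S. d x y = d y x) \<and>
     (\<forall>x\<in>S. \<forall>y\<in>S. \<forall>z\<in>S. d x z \<le> d x y + d y z)"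

definition infty_complete_on :: "'a set \<Rightarrow> ('a \<Rightarrow> 'a \<Rightarrow> ennreal) \<Rightarrow> bool" where
  "infty_complete_on S d \<longleftrightarrow>
     (\<forall>s :: nat \<Rightarrow> 'a.
        (\<forall>i. s i \<in> S) \<and>
        (\<forall>\<epsilon>::real. \<epsilon> > 0 \<longrightarrow> (\<exists>N. \<forall>i\<ge>N. \<forall>j\<ge>N. d (s i) (s j) < ennreal \<epsilon>))
        \<longrightarrow> (\<exists>l\<in>S. (\<lambda>i. d (s i) l) \<longlonglongrightarrow> 0))"

text \<open>A single function \<open>hdist\<close> on arrows carries the distances of all hom-sets; its values
  on non-parallel arrows are irrelevant.\<close>

record ('o, 'm) mu_category = "('o, 'm) category" +
  hdist :: "'m \<Rightarrow> 'm \<Rightarrow> ennreal"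

definition eps_delta_continuous ::
    "('o, 'm, 'z) mu_category_scheme \<Rightarrow> real \<Rightarrow> real \<Rightarrow> 'm \<Rightarrow> bool" where
  "eps_delta_continuous K \<epsilon> \<delta> f \<longleftrightarrow>
     (\<forall>W \<in> Obj K. \<forall>g \<in> Hom K W (Dom K f). \<forall>h \<in> Hom K W (Dom K f).
        hdist K g h < ennreal \<delta> \<longrightarrow> hdist K (f \<cdot>\<^bsub>K\<^esub> g) (f \<cdot>\<^bsub>K\<^esub> h) < ennreal \<epsilon>)"

definition approx :: "('o, 'm, 'z) mu_category_scheme \<Rightarrow> real \<Rightarrow> 'm \<Rightarrow> 'm \<Rightarrow> bool" where
  "approx K \<epsilon> f g \<longleftrightarrow> hdist K f g < ennreal \<epsilon>"

locale MU_category = category K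
  for K :: "('o, 'm, 'z) mu_category_scheme" (structure) +
  assumes hdist_metric:
      "\<lbrakk>A \<in> Obj K; B \<in> Obj K\<rbrakk> \<Longrightarrow> infty_metric_on (Hom K A B) (hdist K)"
    and hdist_precomp:
      "\<lbrakk>f \<in> Hom K A B; g \<in> Hom K B C; h \<in> Hom K B C\<rbrakk>
         \<Longrightarrow> hdist K (g \<cdot> f) (h \<cdot> f) \<le> hdist K g h"
    and maps_continuous:
      "\<And>\<epsilon>::real. \<lbrakk>f \<in> Arr K; \<epsilon> > 0\<rbrakk> \<Longrightarrow> \<exists>\<delta>>0. eps_delta_continuous K \<epsilon> \<delta> f"

locale locally_complete_MU_category = MU_category +
  assumes hom_complete:
      "\<lbrakk>A \<in> Obj K; B \<in> Obj K\<rbrakk> \<Longrightarrow> infty_complete_on (Hom K A B) (hdist K)"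

definition inverse_sequence ::
    "('o, 'm, 'z) category_scheme \<Rightarrow> (nat \<Rightarrow> 'o) \<Rightarrow> (nat \<Rightarrow> 'm) \<Rightarrow> bool" where
  "inverse_sequence K X f \<longleftrightarrow> (\<forall>n. X n \<in> Obj K \<and> f n \<in> Hom K (X (Suc n)) (X n))"

text \<open>\<open>iter_comp K X f n k\<close> is the composite \<open>f n \<cdot> \<dots> \<cdot> f (n + k - 1)\<close> of \<open>k\<close> maps;
  \<open>bond K X f n n'\<close> is \<open>f\<^bsub>n,n'\<^esub>\<close> and is meaningful only for \<open>n \<le> n'\<close>.\<close>

primrec iter_comp ::
    "('o, 'm, 'z) category_scheme \<Rightarrow> (nat \<Rightarrow> 'o) \<Rightarrow> (nat \<Rightarrow> 'm) \<Rightarrow> nat \<Rightarrow> nat \<Rightarrow> 'm" where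
  "iter_comp K X f n 0 = Ident K (X n)"
| "iter_comp K X f n (Suc k) = iter_comp K X f n k \<cdot>\<^bsub>K\<^esub> f (n + k)"

definition bond ::
    "('o, 'm, 'z) category_scheme \<Rightarrow> (nat \<Rightarrow> 'o) \<Rightarrow> (nat \<Rightarrow> 'm) \<Rightarrow> nat \<Rightarrow> nat \<Rightarrow> 'm" where
  "bond K X f n n' = iter_comp K X f n (n' - n)"

definition subseq_obj :: "(nat \<Rightarrow> 'o) \<Rightarrow> (nat \<Rightarrow> nat) \<Rightarrow> nat \<Rightarrow> 'o" where
  "subseq_obj X m k = X (m k)"

definition subseq_map ::
    "('o, 'm, 'z) category_scheme \<Rightarrow> (nat \<Rightarrow> 'o) \<Rightarrow> (nat \<Rightarrow> 'm) \<Rightarrow> (nat \<Rightarrow> nat) \<Rightarrow> nat \<Rightarrow> 'm" where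
  "subseq_map K X f m k = bond K X f (m k) (m (Suc k))"

definition epsilon_sequence ::
    "('o, 'm, 'z) mu_category_scheme \<Rightarrow> (nat \<Rightarrow> 'o) \<Rightarrow> (nat \<Rightarrow> 'm) \<Rightarrow> (nat \<Rightarrow> real) \<Rightarrow> bool" where
  "epsilon_sequence K X f \<epsilon> \<longleftrightarrow>
     (\<forall>n. \<epsilon> n > 0) \<and>
     (\<forall>n n'. n \<le> n' \<longrightarrow> eps_delta_continuous K (\<epsilon> n / 2 ^ (n' - n)) (\<epsilon> n') (bond K X f n n'))"

definition cone ::
    "('o, 'm, 'z) category_scheme \<Rightarrow> (nat \<Rightarrow> 'o) \<Rightarrow> (nat \<Rightarrow> 'm) \<Rightarrow> 'o \<Rightarrow> (nat \<Rightarrow> 'm) \<Rightarrow> bool" where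
  "cone K X f W p \<longleftrightarrow> W \<in> Obj K \<and> (\<forall>n. p n \<in> Hom K W (X n)) \<and>
     (\<forall>n n'. n \<le> n' \<longrightarrow> bond K X f n n' \<cdot>\<^bsub>K\<^esub> p n' = p n)"

definition is_limit ::
    "('o, 'm, 'z) category_scheme \<Rightarrow> (nat \<Rightarrow> 'o) \<Rightarrow> (nat \<Rightarrow> 'm) \<Rightarrow> 'o \<Rightarrow> (nat \<Rightarrow> 'm) \<Rightarrow> bool" where
  "is_limit K X f L p \<longleftrightarrow> cone K X f L p \<and>
     (\<forall>W q. cone K X f W q \<longrightarrow> (\<exists>!u. u \<in> Hom K W L \<and> (\<forall>n. p n \<cdot>\<^bsub>K\<^esub> u = q n)))"

definition has_limit ::
    "('o, 'm, 'z) category_scheme \<Rightarrow> (nat \<Rightarrow> 'o) \<Rightarrow> (nat \<Rightarrow> 'm) \<Rightarrow> bool" where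
  "has_limit K X f \<longleftrightarrow> (\<exists>L p. is_limit K X f L p)"

end

theory Submission imports Defs begin

text \<open>A cone \<open>p\<close> over \<open>f\<^bsub>m\<^sub>*\<^esub>\<close> determines a cone \<open>q\<close> over \<open>g\<^bsub>n\<^sub>*\<^esub>\<close> with the same vertex by
  \<open>q\<^sub>k = lim\<^sub>j g\<^bsub>n\<^sub>k,n\<^sub>j\<^esub> h\<^bsub>2j\<^esub> p\<^sub>j\<close>: two consecutive terms are less than \<open>\<epsilon>\<^sub>k/2\<^bsup>j-k\<^esup>\<close> apart, so local
  completeness yields the limit, at distance less than \<open>2\<epsilon>\<^sub>k\<close> from \<open>h\<^bsub>2k\<^esub> p\<^sub>k\<close>. The hypotheses are
  symmetric under exchanging the two sequences and shifting one of them by one step, and the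
  construction in the other direction is inverse to this one. Hence cones over the two
  sequences correspond bijectively and naturally in the vertex, so limits correspond as well;
  the same is true of a sequence and its subsequences.\<close>

section \<open>Limits and strict inequalities for distances that may be infinite\<close>

lemma tendsto_zero_ennreal_iff:
  fixes s :: "nat \<Rightarrow> ennreal"
  shows "s \<longlonglongrightarrow> 0 \<longleftrightarrow> (\<forall>e::real. e > 0 \<longrightarrow> (\<forall>\<^sub>F i in sequentially. s i < ennreal e))"
proof
  assume "s \<longlonglongrightarrow> 0"
  then show "\<forall>e::real. e > 0 \<longrightarrow> (\<forall>\<^sub>F i in sequentially. s i < ennreal e)"
    by (auto intro: order_tendstoD(2))
next
  assume R: "\<forall>e::real. e > 0 \<longrightarrow> (\<forall>\<^sub>F i in sequentially. s i < ennreal e)"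
  show "s \<longlonglongrightarrow> 0"
  proof (rule order_tendstoI)
    fix c :: ennreal assume "0 < c"
    \<comment> \<open>The level \<open>c\<close> may be infinite, so a finite positive
      \<open>d\<close> below it is inserted before the hypothesis about reals is applied.\<close>
    then obtain d where d: "0 < d" "d < c" using dense by blast
    then have "d < top" using less_le_trans top_greatest by blast
    then obtain e where "d = ennreal e" "e \<ge> 0" by (cases d) auto
    with d R have "\<forall>\<^sub>F i in sequentially. s i < d" by (cases "e = 0") auto
    then show "\<forall>\<^sub>F i in sequentially. s i < c" by eventually_elim (use d in auto)
  qed simp
qed

lemma ennreal_add_strict_le:
  assumes "x < ennreal c" "y \<le> ennreal d" "c \<ge> 0" "d \<ge> 0"
  shows "x + y < ennreal (c + d)"
proof -
  have "y < top" using assms(2) ennreal_less_top le_less_trans by blast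
  then obtain r where r: "y = ennreal r" "r \<ge> 0" by (cases y) auto
  have "x < top" using assms(1) ennreal_less_top less_trans by blast
  then obtain t where t: "x = ennreal t" "t \<ge> 0" by (cases x) auto
  show ?thesis using assms r t
    by (simp add: ennreal_plus[symmetric] ennreal_less_iff del: ennreal_plus)
qed

section \<open>Bonding maps, cones and limits in an arbitrary category\<close>

context category
begin

lemma Hom_Obj: "f \<in> Hom K A B \<Longrightarrow> A \<in> Obj K" "f \<in> Hom K A B \<Longrightarrow> B \<in> Obj K"
  using Dom_in_Obj Cod_in_Obj unfolding Hom_def by auto

lemma iter_comp_Hom:
  assumes "inverse_sequence K X f"
  shows "iter_comp K X f n k \<in> Hom K (X (n + k)) (X n)"
proof (induction k)
  case 0
  then show ?case using assms by (simp add: inverse_sequence_def Ident_in_Hom)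
next
  case (Suc k)
  then show ?case using assms by (auto simp: inverse_sequence_def intro: Comp_in_Hom)
qed

lemma bond_Hom:
  assumes "inverse_sequence K X f" "i \<le> j"
  shows "bond K X f i j \<in> Hom K (X j) (X i)"
  using iter_comp_Hom[OF assms(1), of i "j - i"] assms(2) by (simp add: bond_def)

lemma iter_comp_add:
  assumes "inverse_sequence K X f"
  shows "iter_comp K X f n (k + l) = iter_comp K X f n k \<cdot> iter_comp K X f (n + k) l"
proof (induction l)
  case 0
  then show ?case using Comp_Ident[OF iter_comp_Hom[OF assms]] by simp
next
  case (Suc l)
  have "f (n + k + l) \<in> Hom K (X (Suc (n + k + l))) (X (n + k + l))"
    using assms by (simp add: inverse_sequence_def)
  from Comp_assoc[OF this iter_comp_Hom[OF assms] iter_comp_Hom[OF assms]] Suc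
  show ?case by (simp add: add.assoc)
qed

lemma bond_bond:
  assumes "inverse_sequence K X f" "i \<le> j" "j \<le> k"
  shows "bond K X f i j \<cdot> bond K X f j k = bond K X f i k"
  using iter_comp_add[OF assms(1), of i "j - i" "k - j"] assms(2,3) by (simp add: bond_def)

lemma bond_Suc:
  assumes "inverse_sequence K X f"
  shows "bond K X f i (Suc i) = f i"
  using assms Ident_Comp by (fastforce simp: bond_def inverse_sequence_def)

lemma coneI:
  assumes X: "inverse_sequence K X f" and p: "\<And>i. p i \<in> Hom K W (X i)"
    and step: "\<And>i. f i \<cdot> p (Suc i) = p i"
  shows "cone K X f W p"
proof -
  have "iter_comp K X f i k \<cdot> p (i + k) = p i" for i k
  proof (induction k)
    case 0
    then show ?case using Ident_Comp[OF p] by simp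
  next
    case (Suc k)
    have f: "f (i + k) \<in> Hom K (X (Suc (i + k))) (X (i + k))"
      using X by (simp add: inverse_sequence_def)
    show ?case using Comp_assoc[OF p f iter_comp_Hom[OF X]] Suc step by simp
  qed
  then have "bond K X f i j \<cdot> p j = p i" if "i \<le> j" for i j
    using that by (metis bond_def le_add_diff_inverse)
  moreover have "W \<in> Obj K" using Hom_Obj(1)[OF p] .
  ultimately show ?thesis using p by (auto simp: cone_def)
qed

lemma cone_Hom: "cone K X f W p \<Longrightarrow> p i \<in> Hom K W (X i)"
  by (simp add: cone_def)

lemma cone_iter: "cone K X f W p \<Longrightarrow> iter_comp K X f i k \<cdot> p (i + k) = p i"
  by (metis add_diff_cancel_left' bond_def cone_def le_add1)

lemma cone_step:
  assumes "inverse_sequence K X f" "cone K X f W p"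
  shows "f i \<cdot> p (Suc i) = p i"
  using assms bond_Suc[OF assms(1)] by (metis cone_def le_SucI order_refl)

lemma cone_comp:
  assumes X: "inverse_sequence K X f" and p: "cone K X f L p" and u: "u \<in> Hom K W L"
  shows "cone K X f W (\<lambda>i. p i \<cdot> u)"
proof (rule coneI[OF X])
  show "p i \<cdot> u \<in> Hom K W (X i)" for i
    using Comp_in_Hom[OF u cone_Hom[OF p]] .
  have "f i \<in> Hom K (X (Suc i)) (X i)" for i using X by (simp add: inverse_sequence_def)
  then show "f i \<cdot> p (Suc i) \<cdot> u = p i \<cdot> u" for i
    using Comp_assoc[OF u cone_Hom[OF p]] cone_step[OF X p] by metis
qed

lemma is_limit_cone: "is_limit K X f L p \<Longrightarrow> cone K X f L p"
  by (simp add: is_limit_def)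

text \<open>If \<open>R\<close> is a bijection between cones with a common vertex, natural in that
  vertex, then \<open>u\<close> factors \<open>s\<close> through \<open>q\<close> exactly when it
  factors the partner \<open>r\<close> of \<open>s\<close> through \<open>p\<close>; unique
  factorization therefore carries over. Stating this for a relation lets one lemma serve both
  directions of a correspondence: only the arguments of \<open>R\<close> are exchanged.\<close>

lemma is_limit_transfer:
  assumes lim: "is_limit K X f L p" and L: "R L p q" "cone K Y g L q"
    and X: "inverse_sequence K X f" and Y: "inverse_sequence K Y g"
    and natural: "\<And>W u. u \<in> Hom K W L \<Longrightarrow> R W (\<lambda>i. p i \<cdot> u) (\<lambda>i. q i \<cdot> u)"
    and surj: "\<And>W s. cone K Y g W s \<Longrightarrow> \<exists>r. cone K X f W r \<and> R W r s"
    and functional: "\<And>W r s s'. \<lbrakk>cone K X f W r; cone K Y g W s; cone K Y g W s'; R W r s; R W r s'\<rbrakk> \<Longrightarrow> s = s'"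
    and inj: "\<And>W r r' s. \<lbrakk>cone K X f W r; cone K X f W r'; cone K Y g W s; R W r s; R W r' s\<rbrakk> \<Longrightarrow> r = r'"
  shows "is_limit K Y g L q"
  unfolding is_limit_def
proof (intro conjI allI impI L(2))
  fix W s assume s: "cone K Y g W s"
  obtain r where r: "cone K X f W r" "R W r s" using surj[OF s] by blast
  note p = is_limit_cone[OF lim]
  have uniq: "\<exists>!u. u \<in> Hom K W L \<and> (\<forall>i. p i \<cdot> u = r i)"
    using lim r(1) by (simp add: is_limit_def)
  have "(\<forall>i. q i \<cdot> u = s i) \<longleftrightarrow> (\<forall>i. p i \<cdot> u = r i)" if u: "u \<in> Hom K W L" for u
  proof
    assume "\<forall>i. q i \<cdot> u = s i"
    then have "R W (\<lambda>i. p i \<cdot> u) s" using natural[OF u] by simp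
    from inj[OF cone_comp[OF X p u] r(1) s this r(2)] show "\<forall>i. p i \<cdot> u = r i" by meson
  next
    assume "\<forall>i. p i \<cdot> u = r i"
    then have "R W r (\<lambda>i. q i \<cdot> u)" using natural[OF u] by simp
    from functional[OF r(1) cone_comp[OF Y L(2) u] s this r(2)] show "\<forall>i. q i \<cdot> u = s i" by meson
  qed
  then show "\<exists>!u. u \<in> Hom K W L \<and> (\<forall>i. q i \<cdot> u = s i)" using uniq by metis
qed

lemma is_limit_isomorphism:
  assumes X: "inverse_sequence K X f" and p: "is_limit K X f L p" and q: "is_limit K X f M q"
  shows "\<exists>u. isomorphism K L M u \<and> (\<forall>i. q i \<cdot> u = p i)"
proof -
  note cp = is_limit_cone[OF p] and cq = is_limit_cone[OF q]
  obtain u where u: "u \<in> Hom K L M" "\<And>i. q i \<cdot> u = p i"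
    using q cp unfolding is_limit_def by metis
  obtain v where v: "v \<in> Hom K M L" "\<And>i. p i \<cdot> v = q i"
    using p cq unfolding is_limit_def by metis
  have pvu: "p i \<cdot> v \<cdot> u = p i" for i using Comp_assoc[OF u(1) v(1) cone_Hom[OF cp]] u v by metis
  have quv: "q i \<cdot> u \<cdot> v = q i" for i using Comp_assoc[OF v(1) u(1) cone_Hom[OF cq]] u v by metis
  have "\<exists>!w. w \<in> Hom K L L \<and> (\<forall>i. p i \<cdot> w = p i)" using p cp by (simp add: is_limit_def)
  then have "v \<cdot> u = Ident K L"
    using pvu Comp_in_Hom[OF u(1) v(1)] Ident_in_Hom[OF Hom_Obj(1)[OF u(1)]] Comp_Ident[OF cone_Hom[OF cp]] by metis
  moreover have "\<exists>!w. w \<in> Hom K M M \<and> (\<forall>i. q i \<cdot> w = q i)" using q cq by (simp add: is_limit_def)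
  then have "u \<cdot> v = Ident K M"
    using quv Comp_in_Hom[OF v(1) u(1)] Ident_in_Hom[OF Hom_Obj(1)[OF v(1)]] Comp_Ident[OF cone_Hom[OF cq]] by metis
  ultimately show ?thesis using u v by (auto simp: isomorphism_def)
qed

section \<open>Passing between a sequence and its subsequences\<close>

lemma inverse_sequence_subseq:
  assumes X: "inverse_sequence K X f" and m: "strict_mono m"
  shows "inverse_sequence K (subseq_obj X m) (subseq_map K X f m)"
proof -
  have "m k \<le> m (Suc k)" for k using m by (simp add: strict_mono_less_eq)
  then show ?thesis
    using bond_Hom[OF X] X by (simp add: inverse_sequence_def subseq_obj_def subseq_map_def)
qed

lemma cone_subseq:
  assumes X: "inverse_sequence K X f" and m: "strict_mono m" and p: "cone K X f W p"
  shows "cone K (subseq_obj X m) (subseq_map K X f m) W (p \<circ> m)"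
proof (rule coneI[OF inverse_sequence_subseq[OF X m]])
  show "(p \<circ> m) i \<in> Hom K W (subseq_obj X m i)" for i
    using cone_Hom[OF p] by (simp add: subseq_obj_def)
  have "m i \<le> m (Suc i)" for i using m by (simp add: strict_mono_less_eq)
  then show "subseq_map K X f m i \<cdot> (p \<circ> m) (Suc i) = (p \<circ> m) i" for i
    using p by (simp add: cone_def subseq_map_def)
qed

text \<open>Every index \<open>i\<close> lies below \<open>m i\<close>, so the missing component at
  \<open>i\<close> can be pulled down from \<open>q i\<close>. Any \<open>q k\<close> with
  \<open>i \<le> m k\<close> yields the same map, which makes the components compatible and shows
  that the old ones are recovered.\<close>

lemma cone_subseq_extend:
  assumes X: "inverse_sequence K X f" and m: "strict_mono m"
    and q: "cone K (subseq_obj X m) (subseq_map K X f m) W q"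
  shows "\<exists>p. cone K X f W p \<and> q = p \<circ> m"
proof -
  note S = inverse_sequence_subseq[OF X m]
  have le: "i \<le> m i" for i using m by (rule strict_mono_imp_increasing)
  have mono: "m i \<le> m j" if "i \<le> j" for i j using m that by (simp add: strict_mono_less_eq)
  have qH: "q k \<in> Hom K W (X (m k))" for k using cone_Hom[OF q] by (simp add: subseq_obj_def)
  have indep: "bond K X f i (m (k + l)) \<cdot> q (k + l) = bond K X f i (m k) \<cdot> q k" if "i \<le> m k" for i k l
  proof (induction l)
    case (Suc l)
    let ?j = "k + l"
    have "m k \<le> m ?j" "m ?j \<le> m (Suc ?j)" by (auto intro: mono)
    then have i: "i \<le> m ?j" and j: "m ?j \<le> m (Suc ?j)" using that by auto
    have "bond K X f i (m (Suc ?j)) \<cdot> q (Suc ?j)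
        = bond K X f i (m ?j) \<cdot> (bond K X f (m ?j) (m (Suc ?j)) \<cdot> q (Suc ?j))"
      using Comp_assoc[OF qH bond_Hom[OF X j] bond_Hom[OF X i]] bond_bond[OF X i j] by simp
    also have "\<dots> = bond K X f i (m ?j) \<cdot> q ?j"
      using cone_step[OF S q] by (simp add: subseq_map_def)
    finally show ?case using Suc by simp
  qed simp
  have indep': "bond K X f i (m l) \<cdot> q l = bond K X f i (m k) \<cdot> q k" if "i \<le> m k" "k \<le> l" for i k l
    using indep[OF that(1), of "l - k"] that(2) by simp
  define p where "p i = bond K X f i (m i) \<cdot> q i" for i
  have "cone K X f W p"
  proof (rule coneI[OF X])
    show "p i \<in> Hom K W (X i)" for i
      unfolding p_def using Comp_in_Hom[OF qH bond_Hom[OF X le]] .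
    show "f i \<cdot> p (Suc i) = p i" for i
    proof -
      have b: "bond K X f i (Suc i) \<in> Hom K (X (Suc i)) (X i)" by (rule bond_Hom[OF X]) simp
      have "f i \<cdot> p (Suc i) = bond K X f i (Suc i) \<cdot> (bond K X f (Suc i) (m (Suc i)) \<cdot> q (Suc i))"
        by (simp add: p_def bond_Suc[OF X])
      also have "\<dots> = bond K X f i (m (Suc i)) \<cdot> q (Suc i)"
        using Comp_assoc[OF qH bond_Hom[OF X le] b] bond_bond[OF X _ le, of i "Suc i"] by simp
      also have "\<dots> = p i" unfolding p_def by (rule indep'[OF le]) simp
      finally show ?thesis .
    qed
  qed
  moreover have "q k = p (m k)" for k
  proof -
    have "p (m k) = bond K X f (m k) (m k) \<cdot> q k" unfolding p_def by (rule indep'[OF order_refl le])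
    then show ?thesis using Ident_Comp[OF qH] by (simp add: bond_def)
  qed
  ultimately show ?thesis by (intro exI[of _ p]) auto
qed

text \<open>The range of \<open>m\<close> is cofinal: the component at \<open>i\<close> is the image
  of the component at \<open>m i\<close> under a bonding map.\<close>

lemma cone_subseq_inj:
  fixes m :: "nat \<Rightarrow> nat"
  assumes "strict_mono m" "cone K X f W p" "cone K X f W p'" "p \<circ> m = p' \<circ> m"
  shows "p = p'"
proof
  fix i
  have "p (m i) = p' (m i)" using assms(4) by (metis comp_apply)
  moreover have "i \<le> m i" using assms(1) by (rule strict_mono_imp_increasing)
  ultimately show "p i = p' i" using assms(2,3) by (metis cone_def)
qed

lemma is_limit_subseq:
  assumes X: "inverse_sequence K X f" and m: "strict_mono m" and p: "is_limit K X f L p"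
  shows "is_limit K (subseq_obj X m) (subseq_map K X f m) L (p \<circ> m)"
proof (rule is_limit_transfer[OF p, where R = "\<lambda>_ r s. s = r \<circ> m"])
  show "cone K (subseq_obj X m) (subseq_map K X f m) L (p \<circ> m)"
    using cone_subseq[OF X m is_limit_cone[OF p]] .
  show "\<exists>r. cone K X f W r \<and> s = r \<circ> m"
    if "cone K (subseq_obj X m) (subseq_map K X f m) W s" for W s
    using cone_subseq_extend[OF X m that] .
  show "r = r'" if "cone K X f W r" "cone K X f W r'" "s = r \<circ> m" "s = r' \<circ> m"
    for W r r' s using cone_subseq_inj[OF m that(1,2)] that(3,4) by simp
qed (use X m in \<open>auto simp: comp_def inverse_sequence_subseq\<close>)

lemma is_limit_subseq_extend:
  assumes X: "inverse_sequence K X f" and m: "strict_mono m"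
    and q: "is_limit K (subseq_obj X m) (subseq_map K X f m) L q"
  shows "\<exists>p. is_limit K X f L p"
proof -
  obtain p where p: "cone K X f L p" "q = p \<circ> m"
    using cone_subseq_extend[OF X m is_limit_cone[OF q]] by blast
  have "is_limit K X f L p"
  proof (rule is_limit_transfer[OF q, where R = "\<lambda>_ r s. r = s \<circ> m"])
    show "\<exists>r. cone K (subseq_obj X m) (subseq_map K X f m) W r \<and> r = s \<circ> m"
      if "cone K X f W s" for W s using cone_subseq[OF X m that] by blast
    show "s = s'" if "cone K X f W s" "cone K X f W s'" "r = s \<circ> m" "r = s' \<circ> m"
      for W r s s' using cone_subseq_inj[OF m that(1,2)] that(3,4) by simp
  qed (use p X m in \<open>auto simp: comp_def inverse_sequence_subseq\<close>)
  then show ?thesis by blast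
qed

lemma has_limit_subseq_iff:
  assumes "inverse_sequence K X f" "strict_mono m"
  shows "has_limit K (subseq_obj X m) (subseq_map K X f m) \<longleftrightarrow> has_limit K X f"
  using is_limit_subseq[OF assms] is_limit_subseq_extend[OF assms] unfolding has_limit_def by blast

end

section \<open>Dropping the first term of a sequence\<close>

lemma iter_comp_shift:
  "iter_comp K (\<lambda>k. X (Suc k)) (\<lambda>k. f (Suc k)) n k = iter_comp K X f (Suc n) k"
  by (induction k) simp_all

lemma epsilon_sequence_shift:
  "epsilon_sequence K X f \<epsilon> \<Longrightarrow>
    epsilon_sequence K (\<lambda>k. X (Suc k)) (\<lambda>k. f (Suc k)) (\<lambda>k. \<epsilon> (Suc k))"
  unfolding epsilon_sequence_def bond_def iter_comp_shift
  by (metis Suc_le_mono diff_Suc_Suc)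

section \<open>Distances in hom-sets and geometrically convergent sequences\<close>

context MU_category
begin

lemma hdist_eq_0_iff: "\<lbrakk>g \<in> Hom K A B; h \<in> Hom K A B\<rbrakk> \<Longrightarrow> hdist K g h = 0 \<longleftrightarrow> g = h"
  using hdist_metric[OF Hom_Obj] unfolding infty_metric_on_def by blast

lemma hdist_commute: "\<lbrakk>g \<in> Hom K A B; h \<in> Hom K A B\<rbrakk> \<Longrightarrow> hdist K g h = hdist K h g"
  using hdist_metric[OF Hom_Obj] unfolding infty_metric_on_def by blast

lemma hdist_triangle:
  "\<lbrakk>f \<in> Hom K A B; g \<in> Hom K A B; h \<in> Hom K A B\<rbrakk> \<Longrightarrow> hdist K f h \<le> hdist K f g + hdist K g h"
  using hdist_metric[OF Hom_Obj] unfolding infty_metric_on_def by blast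

lemma hdist_triangle_less:
  assumes "f \<in> Hom K A B" "g \<in> Hom K A B" "h \<in> Hom K A B"
    and "hdist K f g < ennreal c" "hdist K g h < ennreal d"
  shows "hdist K f h < ennreal (c + d)"
proof -
  \<comment> \<open>\<open>ennreal\<close> sends negative reals to 0, and nothing lies strictly
    below 0; the strict bounds thus force \<open>c\<close> and \<open>d\<close> to be
    positive.\<close>
  have "0 < c" "0 < d" using assms(4,5) by (metis ennreal_neg not_less not_less_zero)+
  then show ?thesis
    using ennreal_add_strict_le[OF assms(4) less_imp_le[OF assms(5)]] hdist_triangle[OF assms(1-3)]
    by (meson le_less_trans less_imp_le)
qed

lemma hdist_limit_unique:
  assumes s: "\<And>i. s i \<in> Hom K A B" and l: "l \<in> Hom K A B" and l': "l' \<in> Hom K A B"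
    and "(\<lambda>i. hdist K (s i) l) \<longlonglongrightarrow> 0" "(\<lambda>i. hdist K (s i) l') \<longlonglongrightarrow> 0"
  shows "l = l'"
proof -
  have "(\<lambda>i. hdist K (s i) l + hdist K (s i) l') \<longlonglongrightarrow> 0 + 0"
    using assms(4,5) by (rule tendsto_add)
  moreover have "hdist K l l' \<le> hdist K (s i) l + hdist K (s i) l'" for i
    using hdist_triangle[OF l s l'] hdist_commute[OF l s] by metis
  ultimately have "hdist K l l' \<le> 0 + 0" by (intro LIMSEQ_le_const) auto
  then show ?thesis using hdist_eq_0_iff[OF l l'] by simp
qed

lemma hdist_precomp_tendsto:
  assumes s: "\<And>i. s i \<in> Hom K A B" and l: "l \<in> Hom K A B" and u: "u \<in> Hom K W A"
    and lim: "(\<lambda>i. hdist K (s i) l) \<longlonglongrightarrow> 0"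
  shows "(\<lambda>i. hdist K (s i \<cdot> u) (l \<cdot> u)) \<longlonglongrightarrow> 0"
  by (rule tendsto_sandwich[OF _ _ tendsto_const lim]) (simp_all add: hdist_precomp[OF u s l])

lemma eps_delta_continuousD:
  assumes "eps_delta_continuous K e d f" "f \<in> Hom K A B" "g \<in> Hom K W A" "h \<in> Hom K W A"
    and "hdist K g h < ennreal d"
  shows "hdist K (f \<cdot> g) (f \<cdot> h) < ennreal e"
proof -
  have "Dom K f = A" using assms(2) by (simp add: Hom_def)
  then show ?thesis using assms Hom_Obj(1)[OF assms(3)] unfolding eps_delta_continuous_def by blast
qed

text \<open>No rate is claimed here: \<open>maps_continuous\<close> gives some modulus
  \<open>d\<close> for each \<open>e\<close>, uniformly in the maps composed with \<open>f\<close>,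
  and that is enough for convergence.\<close>

lemma hdist_postcomp_tendsto:
  assumes s: "\<And>i. s i \<in> Hom K W A" and l: "l \<in> Hom K W A" and f: "f \<in> Hom K A B"
    and lim: "(\<lambda>i. hdist K (s i) l) \<longlonglongrightarrow> 0"
  shows "(\<lambda>i. hdist K (f \<cdot> s i) (f \<cdot> l)) \<longlonglongrightarrow> 0"
  unfolding tendsto_zero_ennreal_iff
proof (intro allI impI)
  fix e :: real assume "e > 0"
  then obtain d where d: "d > 0" "eps_delta_continuous K e d f"
    using maps_continuous[of f] f by (auto simp: Hom_def)
  then have "\<forall>\<^sub>F i in sequentially. hdist K (s i) l < ennreal d"
    using lim unfolding tendsto_zero_ennreal_iff by blast
  then show "\<forall>\<^sub>F i in sequentially. hdist K (f \<cdot> s i) (f \<cdot> l) < ennreal e"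
    by eventually_elim (rule eps_delta_continuousD[OF d(2) f s l])
qed

text \<open>The bound is the exact partial sum of \<open>c / 2 ^ i\<close> over \<open>r\<close>
  consecutive terms. Keeping the subtracted tail is what makes the induction on \<open>r\<close>
  close.\<close>

lemma hdist_chain_geometric:
  assumes s: "\<And>i. s i \<in> Hom K A B"
    and step: "\<And>i. hdist K (s i) (s (Suc i)) < ennreal (c / 2 ^ i)" and c: "c > 0"
  shows "hdist K (s i) (s (i + r)) \<le> ennreal (2 * c / 2 ^ i - 2 * c / 2 ^ (i + r))"
proof (induction r)
  case 0
  then show ?case using hdist_eq_0_iff[OF s s] by simp
next
  case (Suc r)
  let ?x = "2 * c / 2 ^ i - 2 * c / 2 ^ (i + r)"
  have "2 * c / 2 ^ (i + r) \<le> 2 * c / 2 ^ i"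
    using c by (intro divide_left_mono) (auto simp: power_increasing)
  then have x: "?x \<ge> 0" by simp
  have "hdist K (s i) (s (i + Suc r)) \<le> hdist K (s i) (s (i + r)) + hdist K (s (i + r)) (s (Suc (i + r)))"
    using hdist_triangle[OF s s s] by simp
  also have "\<dots> \<le> ennreal ?x + ennreal (c / 2 ^ (i + r))"
    by (intro add_mono Suc less_imp_le[OF step])
  also have "\<dots> = ennreal (?x + c / 2 ^ (i + r))"
    using x c by (intro ennreal_plus[symmetric]) auto
  also have "?x + c / 2 ^ (i + r) = 2 * c / 2 ^ i - 2 * c / 2 ^ (i + Suc r)"
    by (simp add: field_simps)
  finally show ?case .
qed

lemma hdist_limit_geometric:
  assumes s: "\<And>i. s i \<in> Hom K A B" and l: "l \<in> Hom K A B"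
    and step: "\<And>i. hdist K (s i) (s (Suc i)) < ennreal (c / 2 ^ i)" and c: "c > 0"
    and lim: "(\<lambda>i. hdist K (s i) l) \<longlonglongrightarrow> 0"
  shows "hdist K (s i) l < ennreal (2 * c / 2 ^ i)"
proof -
  have weak: "hdist K (s j) l \<le> ennreal (2 * c / 2 ^ j)" for j
  proof -
    have "hdist K (s j) l \<le> ennreal (2 * c / 2 ^ j) + hdist K (s (j + r)) l" for r
    proof -
      have "hdist K (s j) (s (j + r)) \<le> ennreal (2 * c / 2 ^ j)"
        by (rule order_trans[OF hdist_chain_geometric[OF s step c]]) (use c in \<open>simp add: ennreal_leI\<close>)
      then show ?thesis using hdist_triangle[OF s s l] by (meson add_right_mono order_trans)
    qed
    moreover have "(\<lambda>r. ennreal (2 * c / 2 ^ j) + hdist K (s (j + r)) l) \<longlonglongrightarrow> ennreal (2 * c / 2 ^ j) + 0"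
      using LIMSEQ_ignore_initial_segment[OF lim, of j]
      by (intro tendsto_add tendsto_const) (simp add: add.commute)
    ultimately have "hdist K (s j) l \<le> ennreal (2 * c / 2 ^ j) + 0"
      by (intro LIMSEQ_le_const) auto
    then show ?thesis by simp
  qed
  \<comment> \<open>Passing to the limit gives only the weak inequality. Strictness is regained by
    splitting off the first step, which is strict, and using the weak bound from
    \<open>Suc i\<close> on.\<close>
  have "hdist K (s i) l \<le> hdist K (s i) (s (Suc i)) + hdist K (s (Suc i)) l"
    by (rule hdist_triangle[OF s s l])
  also have "\<dots> < ennreal (c / 2 ^ i + 2 * c / 2 ^ Suc i)"
    by (rule ennreal_add_strict_le[OF step weak]) (use c in auto)
  also have "c / 2 ^ i + 2 * c / 2 ^ Suc i = 2 * c / 2 ^ i" by simp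
  finally show ?thesis .
qed

end

context locally_complete_MU_category
begin

lemma hdist_convergent_geometric:
  assumes s: "\<And>i. s i \<in> Hom K A B"
    and step: "\<And>i. hdist K (s i) (s (Suc i)) < ennreal (c / 2 ^ i)" and c: "c > 0"
  shows "\<exists>l\<in>Hom K A B. (\<lambda>i. hdist K (s i) l) \<longlonglongrightarrow> 0"
proof -
  have close: "hdist K (s i) (s j) \<le> ennreal (2 * c / 2 ^ N)" if "N \<le> i" "i \<le> j" for i j N
  proof -
    have "2 * c / 2 ^ i \<le> 2 * c / 2 ^ N"
      using c that(1) by (intro divide_left_mono) (auto simp: power_increasing)
    moreover have "0 \<le> 2 * c / 2 ^ j" using c by simp
    ultimately have "2 * c / 2 ^ i - 2 * c / 2 ^ j \<le> 2 * c / 2 ^ N" by linarith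
    moreover have "hdist K (s i) (s j) \<le> ennreal (2 * c / 2 ^ i - 2 * c / 2 ^ j)"
      using hdist_chain_geometric[OF s step c, of i "j - i"] that(2) by simp
    ultimately show ?thesis by (meson ennreal_leI order_trans)
  qed
  have "\<exists>N. \<forall>i\<ge>N. \<forall>j\<ge>N. hdist K (s i) (s j) < ennreal e" if e: "e > 0" for e :: real
  proof -
    have "(\<lambda>N. 2 * c * (1 / 2) ^ N) \<longlonglongrightarrow> 2 * c * 0"
      by (intro tendsto_mult tendsto_const LIMSEQ_power_zero) simp
    then have "\<forall>\<^sub>F N in sequentially. 2 * c * (1 / 2) ^ N < e"
      using e by (intro order_tendstoD(2)) auto
    then obtain N where "2 * c * (1 / 2) ^ N < e" by (auto simp: eventually_sequentially)
    then have "ennreal (2 * c / 2 ^ N) < ennreal e"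
      using e by (simp add: power_divide ennreal_lessI)
    then have "hdist K (s i) (s j) < ennreal e" if "N \<le> i" "N \<le> j" for i j
      using close[of N i j] close[of N j i] hdist_commute[OF s s] that
      by (metis le_less_trans nle_le)
    then show ?thesis by blast
  qed
  then show ?thesis
    using hom_complete[OF Hom_Obj(1)[OF s] Hom_Obj(2)[OF s]] s unfolding infty_complete_on_def by blast
qed

end

section \<open>Interleaved sequences and the cones they link\<close>

locale interleaving = locally_complete_MU_category K
  for K :: "('o, 'm, 'z) mu_category_scheme" (structure) +
  fixes U V :: "nat \<Rightarrow> 'o" and F G a b :: "nat \<Rightarrow> 'm" and \<delta> \<epsilon> :: "nat \<Rightarrow> real"
  assumes U: "inverse_sequence K U F" and V: "inverse_sequence K V G"
    and \<delta>: "epsilon_sequence K U F \<delta>" and \<epsilon>: "epsilon_sequence K V G \<epsilon>"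
    and a: "a k \<in> Hom K (U k) (V k)" and b: "b k \<in> Hom K (V (Suc k)) (U k)"
    and a_cont: "eps_delta_continuous K (\<epsilon> k / 2) (\<delta> k) (a k)"
    and b_cont: "eps_delta_continuous K (\<delta> k / 2) (\<epsilon> (Suc k)) (b k)"
    and ab: "hdist K (a k \<cdot> b k) (G k) < ennreal (\<epsilon> k / 2)"
    and ba: "hdist K (b k \<cdot> a (Suc k)) (F k) < ennreal (\<delta> k / 2)"
begin

text \<open>The sequence \<open>V\<close> must lose its first term: \<open>b k\<close> starts at
  \<open>V (Suc k)\<close>, so after the shift it joins equal indices as \<open>a k\<close> did,
  while \<open>a (Suc k)\<close> takes over the role of \<open>b k\<close>. Everything proved in
  this locale thereby holds in the opposite direction as well.\<close>

lemma swap: "interleaving K (\<lambda>k. V (Suc k)) U (\<lambda>k. G (Suc k)) F b (\<lambda>k. a (Suc k)) (\<lambda>k. \<epsilon> (Suc k)) \<delta>"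
  by unfold_locales
    (use U V \<delta> \<epsilon> a b a_cont b_cont ab ba in
      \<open>auto simp: inverse_sequence_def intro: epsilon_sequence_shift\<close>)

lemma F: "F k \<in> Hom K (U (Suc k)) (U k)" and G: "G k \<in> Hom K (V (Suc k)) (V k)"
  using U V by (simp_all add: inverse_sequence_def)

lemma \<delta>_pos: "\<delta> k > 0" and \<epsilon>_pos: "\<epsilon> k > 0"
  using \<delta> \<epsilon> by (simp_all add: epsilon_sequence_def)

lemma F_cont: "eps_delta_continuous K (\<delta> k / 2 ^ i) (\<delta> (k + i)) (iter_comp K U F k i)"
  using \<delta> by (metis add_diff_cancel_left' bond_def epsilon_sequence_def le_add1)

lemma G_cont: "eps_delta_continuous K (\<epsilon> k / 2 ^ i) (\<epsilon> (k + i)) (iter_comp K V G k i)"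
  using \<epsilon> by (metis add_diff_cancel_left' bond_def epsilon_sequence_def le_add1)

text \<open>Here \<open>i\<close> counts from \<open>k\<close>, so the map enters the other sequence
  at index \<open>k + i\<close>. With this offset the step bound is
  \<open>\<epsilon> k / 2 ^ i\<close>, the form required by the geometric estimates.\<close>

definition approximant :: "(nat \<Rightarrow> 'm) \<Rightarrow> nat \<Rightarrow> nat \<Rightarrow> 'm" where
  "approximant p k i = iter_comp K V G k i \<cdot> a (k + i) \<cdot> p (k + i)"

text \<open>A relation treats both cones alike, so it can be read in either direction. Including
  both cone conditions lets uniqueness on either side be stated without side conditions.\<close>

definition linked :: "'o \<Rightarrow> (nat \<Rightarrow> 'm) \<Rightarrow> (nat \<Rightarrow> 'm) \<Rightarrow> bool" where
  "linked W p q \<longleftrightarrow> cone K U F W p \<and> cone K V G W q \<and>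
     (\<forall>k. (\<lambda>i. hdist K (approximant p k i) (q k)) \<longlonglongrightarrow> 0)"

lemma ap_Hom: "cone K U F W p \<Longrightarrow> a k \<cdot> p k \<in> Hom K W (V k)"
  using Comp_in_Hom[OF cone_Hom a] .

lemma approximant_Hom: "cone K U F W p \<Longrightarrow> approximant p k i \<in> Hom K W (V k)"
  unfolding approximant_def using Comp_in_Hom[OF ap_Hom iter_comp_Hom[OF V]] .

lemma approximant_0: "cone K U F W p \<Longrightarrow> approximant p k 0 = a k \<cdot> p k"
  using Ident_Comp[OF ap_Hom] by (simp add: approximant_def)

text \<open>Bonding maps only reindex the approximants. In the limit this makes the maps
  \<open>q k\<close> compatible.\<close>

lemma approximant_iter:
  assumes "cone K U F W p"
  shows "iter_comp K V G k l \<cdot> approximant p (k + l) i = approximant p k (l + i)"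
  using Comp_assoc[OF ap_Hom[OF assms] iter_comp_Hom[OF V] iter_comp_Hom[OF V]]
    iter_comp_add[OF V, of k l i]
  by (simp add: approximant_def add.assoc)

lemma bap_close:
  assumes p: "cone K U F W p"
  shows "hdist K (b j \<cdot> a (Suc j) \<cdot> p (Suc j)) (p j) < ennreal (\<delta> j)"
proof -
  note pS = cone_Hom[OF p, of "Suc j"]
  have "hdist K ((b j \<cdot> a (Suc j)) \<cdot> p (Suc j)) (F j \<cdot> p (Suc j)) < ennreal (\<delta> j / 2)"
    using hdist_precomp[OF pS Comp_in_Hom[OF a b] F] ba by (rule le_less_trans)
  \<comment> \<open>Half of the bound is given away, because \<open>a_cont\<close> and
    \<open>F_cont\<close> ask only for distances below \<open>\<delta> j\<close>.\<close>
  also have "\<dots> \<le> ennreal (\<delta> j)" using \<delta>_pos[of j] by (intro ennreal_leI) simp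
  finally show ?thesis using Comp_assoc[OF pS a b] cone_step[OF U p] by simp
qed

text \<open>One half of \<open>\<epsilon> j\<close> comes from the continuity of \<open>a j\<close>,
  applied to \<open>p j\<close> and \<open>b j \<cdot> a (Suc j) \<cdot> p (Suc j)\<close>; the
  other half comes from replacing \<open>a j \<cdot> b j\<close> by \<open>G j\<close>.\<close>

lemma ap_step:
  assumes p: "cone K U F W p"
  shows "hdist K (a j \<cdot> p j) (G j \<cdot> a (Suc j) \<cdot> p (Suc j)) < ennreal (\<epsilon> j)"
proof -
  note apS = ap_Hom[OF p, of "Suc j"]
  have bap: "b j \<cdot> a (Suc j) \<cdot> p (Suc j) \<in> Hom K W (U j)" using Comp_in_Hom[OF apS b] .
  have "hdist K (p j) (b j \<cdot> a (Suc j) \<cdot> p (Suc j)) < ennreal (\<delta> j)"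
    using bap_close[OF p, of j] hdist_commute[OF bap cone_Hom[OF p]] by simp
  from eps_delta_continuousD[OF a_cont a cone_Hom[OF p] bap this]
  have 1: "hdist K (a j \<cdot> p j) (a j \<cdot> b j \<cdot> a (Suc j) \<cdot> p (Suc j)) < ennreal (\<epsilon> j / 2)" .
  have "hdist K ((a j \<cdot> b j) \<cdot> a (Suc j) \<cdot> p (Suc j)) (G j \<cdot> a (Suc j) \<cdot> p (Suc j)) < ennreal (\<epsilon> j / 2)"
    using hdist_precomp[OF apS Comp_in_Hom[OF b a] G] ab by (rule le_less_trans)
  then have 2: "hdist K (a j \<cdot> b j \<cdot> a (Suc j) \<cdot> p (Suc j)) (G j \<cdot> a (Suc j) \<cdot> p (Suc j)) < ennreal (\<epsilon> j / 2)"
    using Comp_assoc[OF apS b a] by simp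
  show ?thesis
    using hdist_triangle_less[OF ap_Hom[OF p] Comp_in_Hom[OF bap a] Comp_in_Hom[OF apS G] 1 2] by simp
qed

text \<open>This is \<open>ap_step\<close> at index \<open>k + i\<close>, carried down to
  \<open>k\<close>: the epsilon sequence turns distances below \<open>\<epsilon> (k + i)\<close>
  into distances below \<open>\<epsilon> k / 2 ^ i\<close>.\<close>

lemma approximant_step:
  assumes p: "cone K U F W p"
  shows "hdist K (approximant p k i) (approximant p k (Suc i)) < ennreal (\<epsilon> k / 2 ^ i)"
proof -
  have "approximant p k (Suc i) = iter_comp K V G k i \<cdot> G (k + i) \<cdot> a (Suc (k + i)) \<cdot> p (Suc (k + i))"
    using Comp_assoc[OF ap_Hom[OF p] G iter_comp_Hom[OF V]] by (simp add: approximant_def)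
  then show ?thesis
    using eps_delta_continuousD[OF G_cont iter_comp_Hom[OF V] ap_Hom[OF p]
        Comp_in_Hom[OF ap_Hom[OF p] G] ap_step[OF p]]
    by (simp add: approximant_def)
qed

lemma linked_cones: "linked W p q \<Longrightarrow> cone K U F W p" "linked W p q \<Longrightarrow> cone K V G W q"
  by (simp_all add: linked_def)

lemma linked_functional:
  assumes "linked W p q" "linked W p q'"
  shows "q = q'"
proof
  show "q k = q' k" for k
    by (rule hdist_limit_unique[of "approximant p k"])
      (use assms in \<open>auto simp: linked_def intro: approximant_Hom cone_Hom\<close>)
qed

lemma linked_exists:
  assumes p: "cone K U F W p"
  shows "\<exists>q. linked W p q"
proof -
  have "\<forall>k. \<exists>l\<in>Hom K W (V k). (\<lambda>i. hdist K (approximant p k i) l) \<longlonglongrightarrow> 0"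
    using hdist_convergent_geometric[OF approximant_Hom[OF p] approximant_step[OF p] \<epsilon>_pos] by blast
  then obtain q where q: "\<And>k. q k \<in> Hom K W (V k)"
    and lim: "\<And>k. (\<lambda>i. hdist K (approximant p k i) (q k)) \<longlonglongrightarrow> 0" by metis
  \<comment> \<open>Both sides are limits of the approximants at \<open>k\<close> with the first one
    dropped: the left side because \<open>G k\<close> preserves convergence and maps the
    approximants at \<open>Suc k\<close> to them.\<close>
  have "G k \<cdot> q (Suc k) = q k" for k
  proof (rule hdist_limit_unique[of "\<lambda>i. approximant p k (Suc i)"])
    have "G k \<cdot> approximant p (Suc k) i = approximant p k (Suc i)" for i
      using approximant_iter[OF p, of k 1 i] Ident_Comp[OF G] by simp
    then show "(\<lambda>i. hdist K (approximant p k (Suc i)) (G k \<cdot> q (Suc k))) \<longlonglongrightarrow> 0"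
      using hdist_postcomp_tendsto[OF approximant_Hom[OF p] q G lim, of k] by simp
    show "(\<lambda>i. hdist K (approximant p k (Suc i)) (q k)) \<longlonglongrightarrow> 0"
      using lim by (rule LIMSEQ_Suc)
  qed (use approximant_Hom[OF p] q Comp_in_Hom[OF q G] in auto)
  then have "cone K V G W q" using q by (intro coneI[OF V])
  with p lim show ?thesis unfolding linked_def by blast
qed

lemma linked_natural:
  assumes pq: "linked L p q" and u: "u \<in> Hom K W L"
  shows "linked W (\<lambda>i. p i \<cdot> u) (\<lambda>i. q i \<cdot> u)"
proof -
  note p = linked_cones(1)[OF pq] and q = linked_cones(2)[OF pq]
  have "approximant (\<lambda>i. p i \<cdot> u) k i = approximant p k i \<cdot> u" for k i
    using Comp_assoc[OF u cone_Hom[OF p] a] Comp_assoc[OF u ap_Hom[OF p] iter_comp_Hom[OF V]]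
    by (simp add: approximant_def)
  then show ?thesis
    using hdist_precomp_tendsto[OF approximant_Hom[OF p] cone_Hom[OF q] u]
      cone_comp[OF U p u] cone_comp[OF V q u] pq
    unfolding linked_def by simp
qed

text \<open>The distance from \<open>a\<^sub>k p\<^sub>k\<close> to \<open>q\<^sub>k\<close> is only bounded by \<open>2\<epsilon>\<^sub>k\<close>, while the continuity
  of \<open>b\<^bsub>k-1\<^esub>\<close> applies only to distances below \<open>\<epsilon>\<^sub>k\<close>; hence the intermediate point.\<close>

lemma linked_close:
  assumes pq: "linked W p q"
  shows "\<exists>r\<in>Hom K W (V k). hdist K (a k \<cdot> p k) r < ennreal (\<epsilon> k) \<and> hdist K r (q k) < ennreal (\<epsilon> k)"
proof -
  note p = linked_cones(1)[OF pq] and q = linked_cones(2)[OF pq]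
  \<comment> \<open>The intermediate point is \<open>approximant p k 1\<close>: the limit estimate
    \<open>2 * \<epsilon> k / 2 ^ i\<close> equals \<open>\<epsilon> k\<close> at
    \<open>i = 1\<close>.\<close>
  have "hdist K (approximant p k 0) (approximant p k 1) < ennreal (\<epsilon> k)"
    using approximant_step[OF p, of k 0] by simp
  moreover have "hdist K (approximant p k 1) (q k) < ennreal (\<epsilon> k)"
    using hdist_limit_geometric[OF approximant_Hom[OF p] cone_Hom[OF q] approximant_step[OF p] \<epsilon>_pos, of k 1]
      pq by (simp add: linked_def)
  ultimately show ?thesis using approximant_0[OF p] approximant_Hom[OF p] by metis
qed

lemma linked_approx:
  assumes pq: "linked W p q"
  shows "hdist K (a k \<cdot> p k) (q k) < ennreal (2 * \<epsilon> k)"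
  using linked_close[OF pq, of k]
    hdist_triangle_less[OF ap_Hom[OF linked_cones(1)[OF pq]] _ cone_Hom[OF linked_cones(2)[OF pq]]]
  by fastforce

text \<open>The reverse construction applied to \<open>q\<close> returns \<open>p\<close>. At level
  \<open>j = k + i\<close>, the map \<open>b j \<cdot> q (Suc j)\<close> is within
  \<open>\<delta> j\<close> of \<open>b j \<cdot> a (Suc j) \<cdot> p (Suc j)\<close>, which is
  within \<open>\<delta> j\<close> of \<open>p j\<close>. The bonding map down to \<open>k\<close>
  shrinks each distance below \<open>\<delta> k / 2 ^ i\<close>.\<close>

lemma linked_back_tendsto:
  assumes pq: "linked W p q"
  shows "(\<lambda>i. hdist K (iter_comp K U F k i \<cdot> b (k + i) \<cdot> q (Suc (k + i))) (p k)) \<longlonglongrightarrow> 0"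
proof -
  note p = linked_cones(1)[OF pq] and q = linked_cones(2)[OF pq]
  have less: "hdist K (iter_comp K U F k i \<cdot> b (k + i) \<cdot> q (Suc (k + i))) (p k)
      < ennreal (2 * \<delta> k * (1 / 2) ^ i)" for i
  proof -
    let ?j = "k + i"
    let ?B = "iter_comp K U F k i"
    let ?ap = "a (Suc ?j) \<cdot> p (Suc ?j)"
    note B = iter_comp_Hom[OF U, of k i]
    obtain r where r: "r \<in> Hom K W (V (Suc ?j))"
      and apr: "hdist K ?ap r < ennreal (\<epsilon> (Suc ?j))"
      and rq: "hdist K r (q (Suc ?j)) < ennreal (\<epsilon> (Suc ?j))"
      using linked_close[OF pq] by blast
    note apS = ap_Hom[OF p, of "Suc ?j"]
    note qS = cone_Hom[OF q, of "Suc ?j"]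
    note bq = Comp_in_Hom[OF qS b] and bap = Comp_in_Hom[OF apS b] and br = Comp_in_Hom[OF r b]
    \<comment> \<open>Continuity of \<open>b ?j\<close> is applied twice, on either side of
      \<open>r\<close>; each use costs \<open>\<delta> ?j / 2\<close>.\<close>
    have 1: "hdist K (b ?j \<cdot> q (Suc ?j)) (b ?j \<cdot> r) < ennreal (\<delta> ?j / 2)"
      using eps_delta_continuousD[OF b_cont b r qS rq] hdist_commute[OF br bq] by simp
    have 2: "hdist K (b ?j \<cdot> r) (b ?j \<cdot> ?ap) < ennreal (\<delta> ?j / 2)"
      using eps_delta_continuousD[OF b_cont b apS r apr] hdist_commute[OF bap br] by simp
    have "hdist K (b ?j \<cdot> q (Suc ?j)) (b ?j \<cdot> ?ap) < ennreal (\<delta> ?j)"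
      using hdist_triangle_less[OF bq br bap 1 2] by simp
    from eps_delta_continuousD[OF F_cont B bq bap this]
    have 3: "hdist K (?B \<cdot> b ?j \<cdot> q (Suc ?j)) (?B \<cdot> b ?j \<cdot> ?ap) < ennreal (\<delta> k / 2 ^ i)" .
    from eps_delta_continuousD[OF F_cont B bap cone_Hom[OF p] bap_close[OF p]]
    have 4: "hdist K (?B \<cdot> b ?j \<cdot> ?ap) (p k) < ennreal (\<delta> k / 2 ^ i)"
      using cone_iter[OF p] by simp
    show ?thesis
      using hdist_triangle_less[OF Comp_in_Hom[OF bq B] Comp_in_Hom[OF bap B] cone_Hom[OF p] 3 4]
      by (simp add: power_divide)
  qed
  have "(\<lambda>i. 2 * \<delta> k * (1 / 2) ^ i) \<longlonglongrightarrow> 2 * \<delta> k * 0"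
    by (intro tendsto_mult tendsto_const LIMSEQ_power_zero) simp
  then have lim: "(\<lambda>i. ennreal (2 * \<delta> k * (1 / 2) ^ i)) \<longlonglongrightarrow> 0"
    using tendsto_ennrealI by fastforce
  show ?thesis
    by (rule tendsto_sandwich[OF _ _ tendsto_const lim]) (simp_all add: less_imp_le[OF less])
qed

end

section \<open>Exchanging the two sequences, and the transfer of limits\<close>

context interleaving
begin

interpretation sw: interleaving K "\<lambda>k. V (Suc k)" U "\<lambda>k. G (Suc k)" F b "\<lambda>k. a (Suc k)"
  "\<lambda>k. \<epsilon> (Suc k)" \<delta>
  by (rule swap)

lemma cone_shift: "cone K V G W q \<Longrightarrow> cone K (\<lambda>k. V (Suc k)) (\<lambda>k. G (Suc k)) W (\<lambda>k. q (Suc k))"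
  using cone_Hom cone_step[OF V] by (intro coneI[OF sw.U]) auto

lemma linked_imp_sw_linked:
  assumes pq: "linked W p q"
  shows "sw.linked W (\<lambda>k. q (Suc k)) p"
  using linked_back_tendsto[OF pq] linked_cones[OF pq] cone_shift
  unfolding sw.linked_def sw.approximant_def by simp

text \<open>The shifted cone does not contain \<open>q 0\<close>, so the hypothesis that all of
  \<open>q\<close> is a cone is needed to recover it.\<close>

lemma sw_linked_imp_linked:
  assumes q: "cone K V G W q" and qp: "sw.linked W (\<lambda>k. q (Suc k)) p"
  shows "linked W p q"
proof -
  note p = sw.linked_cones(2)[OF qp]
  have lim: "(\<lambda>i. hdist K (approximant p (Suc k) i) (q (Suc k))) \<longlonglongrightarrow> 0" for k
    using sw.linked_back_tendsto[OF qp, of k] by (simp add: iter_comp_shift approximant_def)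
  \<comment> \<open>The exchanged roles give convergence only at the indices \<open>Suc k\<close>.
    Composing with \<open>G k\<close> brings it down to \<open>k\<close>, which covers index
    0.\<close>
  have "(\<lambda>i. hdist K (approximant p k i) (q k)) \<longlonglongrightarrow> 0" for k
  proof -
    have "G k \<cdot> approximant p (Suc k) i = approximant p k (Suc i)" for i
      using approximant_iter[OF p, of k 1 i] Ident_Comp[OF G] by simp
    then have "(\<lambda>i. hdist K (approximant p k (Suc i)) (q k)) \<longlonglongrightarrow> 0"
      using hdist_postcomp_tendsto[OF approximant_Hom[OF p] cone_Hom[OF q] G lim, of k] cone_step[OF V q]
      by simp
    then show ?thesis by (rule LIMSEQ_imp_Suc)
  qed
  then show ?thesis using p q by (simp add: linked_def)
qed

lemma linked_surj:
  assumes "cone K V G W q"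
  shows "\<exists>p. linked W p q"
  using sw.linked_exists[OF cone_shift[OF assms]] sw_linked_imp_linked[OF assms] by blast

lemma linked_inj:
  assumes "linked W p q" "linked W p' q"
  shows "p = p'"
  using sw.linked_functional linked_imp_sw_linked assms by blast

lemma is_limit_forward:
  assumes p: "is_limit K U F L p" and pq: "linked L p q"
  shows "is_limit K V G L q"
proof (rule is_limit_transfer[where R = linked, OF p pq linked_cones(2)[OF pq] U V])
  show "linked W (\<lambda>i. p i \<cdot> u) (\<lambda>i. q i \<cdot> u)" if "u \<in> Hom K W L" for W u
    using linked_natural[OF pq that] .
  show "\<exists>r. cone K U F W r \<and> linked W r s" if "cone K V G W s" for W s
    using linked_surj[OF that] linked_cones(1) by blast
qed (auto dest: linked_functional linked_inj)

lemma is_limit_backward: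
  assumes q: "is_limit K V G L q" and pq: "linked L p q"
  shows "is_limit K U F L p"
proof (rule is_limit_transfer[where R = "\<lambda>W q p. linked W p q", OF q pq linked_cones(1)[OF pq] V U])
  show "linked W (\<lambda>i. p i \<cdot> u) (\<lambda>i. q i \<cdot> u)" if "u \<in> Hom K W L" for W u
    using linked_natural[OF pq that] .
  show "\<exists>r. cone K V G W r \<and> linked W s r" if "cone K U F W s" for W s
    using linked_exists[OF that] linked_cones(2) by blast
qed (auto dest: linked_functional linked_inj)

lemma has_limit_iff: "has_limit K U F \<longleftrightarrow> has_limit K V G"
proof
  assume "has_limit K U F"
  then obtain L p where p: "is_limit K U F L p" by (auto simp: has_limit_def)
  then obtain q where "linked L p q" using linked_exists is_limit_cone by blast
  then show "has_limit K V G" using is_limit_forward[OF p] by (auto simp: has_limit_def)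
next
  assume "has_limit K V G"
  then obtain L q where q: "is_limit K V G L q" by (auto simp: has_limit_def)
  then obtain p where "linked L p q" using linked_surj is_limit_cone by blast
  then show "has_limit K U F" using is_limit_backward[OF q] by (auto simp: has_limit_def)
qed

text \<open>The cone linked to \<open>p\<close> is itself a limit of the second sequence, with
  vertex \<open>L\<close>. Comparing it with \<open>q\<close> gives the isomorphism, and the
  estimate is that for linked cones.\<close>

lemma limit_isomorphism:
  assumes p: "is_limit K U F L p" and q: "is_limit K V G M q"
  shows "\<exists>u. isomorphism K L M u \<and> (\<forall>k. hdist K (a k \<cdot> p k) (q k \<cdot> u) < ennreal (2 * \<epsilon> k))"
proof -
  obtain s where s: "linked L p s" using linked_exists is_limit_cone[OF p] by blast
  obtain u where "isomorphism K L M u" "\<And>k. q k \<cdot> u = s k"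
    using is_limit_isomorphism[OF V is_limit_forward[OF p s] q] by blast
  then show ?thesis using linked_approx[OF s] by auto
qed

end

theorem corollary3p21:
  fixes K :: "('o, 'm, 'z) mu_category_scheme"
    and X Y Z :: "nat \<Rightarrow> 'o" and f g h :: "nat \<Rightarrow> 'm"
    and m n :: "nat \<Rightarrow> nat" and \<delta> \<epsilon> :: "nat \<Rightarrow> real"
  assumes "locally_complete_MU_category K"
    and "inverse_sequence K X f"
    and "inverse_sequence K Y g"
    and "strict_mono m"
    and "strict_mono n"
    and "epsilon_sequence K (subseq_obj X m) (subseq_map K X f m) \<delta>"
    and "epsilon_sequence K (subseq_obj Y n) (subseq_map K Y g n) \<epsilon>"
    and "inverse_sequence K Z h"
    and "\<And>k. h (2 * k) \<in> Hom K (X (m k)) (Y (n k))"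
    and "\<And>k. eps_delta_continuous K (\<epsilon> k / 2) (\<delta> k) (h (2 * k))"
    and "\<And>k. h (2 * k + 1) \<in> Hom K (Y (n (k + 1))) (X (m k))"
    and "\<And>k. eps_delta_continuous K (\<delta> k / 2) (\<epsilon> (k + 1)) (h (2 * k + 1))"
    and "\<And>k. approx K (\<epsilon> k / 2) (h (2 * k) \<cdot>\<^bsub>K\<^esub> h (2 * k + 1)) (bond K Y g (n k) (n (k + 1)))"
    and "\<And>k. approx K (\<delta> k / 2) (h (2 * k + 1) \<cdot>\<^bsub>K\<^esub> h (2 * k + 2)) (bond K X f (m k) (m (k + 1)))"
  shows "(has_limit K X f \<longleftrightarrow> has_limit K Y g) \<and>
    (\<forall>Xinf p Yinf q. is_limit K X f Xinf p \<and> is_limit K Y g Yinf q \<longrightarrow>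
       (\<exists>hinf. isomorphism K Xinf Yinf hinf \<and>
          approx K (2 * \<epsilon> 0) (h 0 \<cdot>\<^bsub>K\<^esub> p (m 0)) (q (n 0) \<cdot>\<^bsub>K\<^esub> hinf)))"
proof -
  interpret locally_complete_MU_category K by (rule assms(1))
  note m = assms(4) and n = assms(5)
  interpret interleaving K "subseq_obj X m" "subseq_obj Y n" "subseq_map K X f m"
    "subseq_map K Y g n" "\<lambda>k. h (2 * k)" "\<lambda>k. h (2 * k + 1)" \<delta> \<epsilon>
    by unfold_locales
      (use assms(6,7,9-14) inverse_sequence_subseq[OF assms(2) m] inverse_sequence_subseq[OF assms(3) n]
        in \<open>auto simp: subseq_obj_def subseq_map_def approx_def\<close>)
  have "has_limit K X f \<longleftrightarrow> has_limit K Y g"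
    using has_limit_iff has_limit_subseq_iff[OF assms(2) m] has_limit_subseq_iff[OF assms(3) n] by simp
  moreover have "\<exists>u. isomorphism K L M u \<and> approx K (2 * \<epsilon> 0) (h 0 \<cdot>\<^bsub>K\<^esub> p (m 0)) (q (n 0) \<cdot>\<^bsub>K\<^esub> u)"
    if p: "is_limit K X f L p" and q: "is_limit K Y g M q" for L p M q
  proof -
    obtain u where "isomorphism K L M u"
      and "\<And>k. hdist K (h (2 * k) \<cdot>\<^bsub>K\<^esub> p (m k)) (q (n k) \<cdot>\<^bsub>K\<^esub> u) < ennreal (2 * \<epsilon> k)"
      using limit_isomorphism[OF is_limit_subseq[OF assms(2) m p] is_limit_subseq[OF assms(3) n q]]
      by auto
    then show ?thesis unfolding approx_def by (metis mult_0_right)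
  qed
  ultimately show ?thesis by blast
qed

end
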